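(* Let $\mathcal{D}\subset \mathcal{K}(\mathit{GL}_d(\mathbb{R}))$ denote the open set of all nonempty compact subsets of $\mathit{GL}_d(\mathbb{R})$ which are $1$-dominated. Then $\check{\varrho} \colon \mathcal{D} \to \mathbb{R}$ is locally Lipschitz continuous.
   Context: $\mathcal{K}(\mathit{GL}_d(\mathbb{R}))$ is the set of all nonempty compact subsets of $\mathit{GL}_d(\mathbb{R})$, equipped with the Hausdorff metric $d_H(\mathsf{A},\mathsf{B}) = \max\{\sup_{A\in\mathsf{A}}\inf_{B\in\mathsf{B}}\|A-B\|, \sup_{B\in\mathsf{B}}\inf_{A\in\mathsf{A}}\|A-B\|\}$, where $\|\cdot\|$ is the Euclidean operator norm. For a nonempty compact set $\mathsf{A}$ of matrices, the lower spectral radius is $$\check{\varrho}(\mathsf{A}) := \lim_{n\to\infty} \inf\{\|A_n\cdots A_1\|^{1/n} : A_1,\dots,A_n \in \mathsf{A}\} = \inf_{n\ge 1} \inf\{\|A_n\cdots A_1\|^{1/n} : A_1,\dots,A_n \in \mathsf{A}\}.$$ Let $\sigma_1(A)\ge \cdots \ge \sigma_d(A)$ denote the singular values of $A$. For $1\le k<d$, $\mathsf{A}\in\mathcal{K}(\mathit{GL}_d(\mathbb{R}))$ is $k$-dominated if one of the following equivalent conditions holds: (a) there exist $C>1$, $\tau\in(0,1)$ such that $\sigma_{k+1}(A_n\cdots A_1)/\sigma_k(A_n\cdots A_1) \le C\tau^n$ for all $n\ge1$ and $A_1,\dots,A_n\in\mathsf{A}$; (b) there exists a set $\mathcal{C}\subset\mathbb{R}^d\setminus\{0\}$,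 relatively closed in $\mathbb{R}^d\setminus\{0\}$, closed under multiplication by nonzero scalars, such that $\bigcup_{A\in\mathsf{A}}A(\mathcal{C})$ is contained in the interior of $\mathcal{C}$, some $k$-dimensional subspace of $\mathbb{R}^d$ is contained in $\mathcal{C}\cup\{0\}$, and some $(d-k)$-dimensional subspace of $\mathbb{R}^d$ does not intersect $\mathcal{C}$. By convention every $\mathsf{A}\in\mathcal{K}(\mathit{GL}_d(\mathbb{R}))$ is $d$-dominated. *)

theory Defs
  imports "HOL-Analysis.Analysis"
begin

(* The norm type class instance on real^'n^'n is the Frobenius norm, so the
   Euclidean operator norm is written out through onorm. *)
definition op_norm :: "real^'n^'n \<Rightarrow> real" where
  "op_norm A = onorm (\<lambda>v. A *v v)"

definition compact_GL :: "(real^'n^'n) set set" where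
  "compact_GL = {\<A>. \<A> \<noteq> {} \<and> compact \<A> \<and> (\<forall>A\<in>\<A>. invertible A)}"

definition hausdorff_dist :: "(real^'n^'n) set \<Rightarrow> (real^'n^'n) set \<Rightarrow> real" where
  "hausdorff_dist \<A> \<B> =
     max (SUP A\<in>\<A>. INF B\<in>\<B>. op_norm (A - B)) (SUP B\<in>\<B>. INF A\<in>\<A>. op_norm (A - B))"

(* mat_prod a n = a n ** ... ** a 1 *)
primrec mat_prod :: "(nat \<Rightarrow> real^'n^'n) \<Rightarrow> nat \<Rightarrow> real^'n^'n" where
  "mat_prod a 0 = mat 1"
| "mat_prod a (Suc n) = a (Suc n) ** mat_prod a n"

(* The term of the sequence at n = 0 is meaningless (root 0 x = 0) and does not
   affect the limit. *)
definition lower_spectral_radius :: "(real^'n^'n) set \<Rightarrow> real" where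
  "lower_spectral_radius \<A> =
     lim (\<lambda>n. Inf {root n (op_norm (mat_prod a n)) | a. \<forall>i\<in>{1..n}. a i \<in> \<A>})"

(* Domination is defined by the existence of a multicone C, which by Bochi and
   Gourmelon is equivalent to a uniform exponential gap between the k-th and the
   (k+1)-st singular values of products; the case k = d is the convention that
   every set is d-dominated. Note that closedness relative to
   the punctured space includes that C does not contain 0. *)
definition multicone :: "nat \<Rightarrow> (real^'n^'n) set \<Rightarrow> (real^'n) set \<Rightarrow> bool" where
  "multicone k \<A> C \<longleftrightarrow>
     closedin (top_of_set (UNIV - {0})) C \<and>
     (\<forall>v\<in>C. \<forall>c. c \<noteq> 0 \<longrightarrow> c *\<^sub>R v \<in> C) \<and>
     (\<Union>A\<in>\<A>. (\<lambda>v. A *v v) ` C) \<subseteq> interior C \<and>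
     (\<exists>E. subspace E \<and> dim E = k \<and> E \<subseteq> C \<union> {0}) \<and>
     (\<exists>F. subspace F \<and> dim F = CARD('n) - k \<and> F \<inter> C = {})"

definition dominated :: "nat \<Rightarrow> (real^'n^'n) set \<Rightarrow> bool" where
  "dominated k \<A> \<longleftrightarrow>
     k = CARD('n) \<or> (1 \<le> k \<and> k < CARD('n) \<and> (\<exists>C. multicone k \<A> C))"

end

theory Submission
  imports Defs
begin

text \<open>
  Let \<open>C\<close> be a multicone of a 1-dominated compact set \<open>\<A>\<close>. By compactness there is a margin
  \<open>\<rho> > 0\<close> such that \<open>C\<close> contains the ball of radius \<open>\<rho> * norm u\<close> around \<open>A *v u\<close> whenever
  \<open>A \<in> \<A>\<close> and \<open>u \<in> C\<close> (\<open>multicone_maps_well_inside\<close>). Half of this margin is left for every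
  set close enough to \<open>\<A>\<close> (\<open>multicone_perturb\<close>), so that the same \<open>C\<close> serves for all nearby
  sets. This gives openness.

  For the Lipschitz estimate, consider vectors \<open>y\<close> such that the functional \<open>v \<mapsto> y \<bullet> v\<close> has
  no zero on \<open>C\<close>. If \<open>A\<close> maps \<open>C\<close> into itself, then composition with \<open>A\<close> preserves this
  property. If it does so with margin \<open>\<rho>\<close>, then
  \<open>\<bar>y \<bullet> (A *v u)\<bar> \<ge> \<rho> * norm u * norm y\<close> for \<open>u \<in> C\<close>, because the kernel of the functional
  misses a whole ball around \<open>A *v u\<close>. Hence replacing \<open>A\<close> by a matrix at distance at most \<open>\<delta>\<close>
  increases \<open>\<bar>y \<bullet> (A *v u)\<bar>\<close> by a factor of at most \<open>1 + \<delta> / \<rho>\<close>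
  (\<open>inner_matrix_perturb_le\<close>). In a product \<open>P\<close> of \<open>n\<close> matrices the factors can be exchanged one
  after the other: what stands to the left of the exchanged factor is absorbed by the functional,
  which still has no zero on \<open>C\<close>, and what stands to the right by the vector, which still belongs
  to \<open>C\<close>. As the errors are relative ones, they multiply, and \<open>\<bar>y \<bullet> (P *v v)\<bar>\<close> grows by a factor of
  at most \<open>(1 + \<delta> / \<rho>) ^ n\<close> (\<open>inner_mat_prod_perturb_le\<close>).

  For a functional whose kernel is the hyperplane disjoint from \<open>C\<close> and for \<open>v\<close> in the
  interior of \<open>C\<close>, the number \<open>\<bar>y \<bullet> (P *v v)\<bar>\<close> equals the norm of \<open>P\<close> up to bounded factors
  (\<open>op_norm_le_inner\<close>), which disappear under the \<open>n\<close>-th root. Since each matrix of one set has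
  a partner in the other one at a distance arbitrarily close to the Hausdorff distance, the lower
  spectral radii of the two sets differ by a factor of at most \<open>1 + \<delta> / \<rho>\<close> for each \<open>\<delta>\<close> above
  that distance. The passage to the limit rests on the existence of the limit in the definition,
  which is Fekete's lemma (\<open>root_submultiplicative_convergent\<close>).
\<close>

section \<open>The operator norm\<close>

lemma op_norm_nonneg: "0 \<le> op_norm A"
  unfolding op_norm_def by (intro onorm_pos_le) simp

lemma norm_matrix_vector_le: "norm (A *v x) \<le> op_norm A * norm x"
  unfolding op_norm_def by (intro onorm) simp

lemma op_norm_le: "(\<And>x. norm (A *v x) \<le> b * norm x) \<Longrightarrow> op_norm (A :: real^'n^'n) \<le> b"
  unfolding op_norm_def by (rule onorm_le)

lemma op_norm_mult_le: "op_norm (A ** B) \<le> op_norm A * op_norm (B :: real^'n^'n)"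
proof (rule op_norm_le)
  fix x
  have "norm ((A ** B) *v x) \<le> op_norm A * norm (B *v x)"
    by (metis matrix_vector_mul_assoc norm_matrix_vector_le)
  also have "\<dots> \<le> op_norm A * (op_norm B * norm x)"
    by (intro mult_left_mono norm_matrix_vector_le op_norm_nonneg)
  finally show "norm ((A ** B) *v x) \<le> op_norm A * op_norm B * norm x"
    by (simp add: mult.assoc)
qed

lemma op_norm_add_le: "op_norm (A + B) \<le> op_norm A + op_norm (B :: real^'n^'n)"
proof (rule op_norm_le)
  fix x
  have "norm ((A + B) *v x) \<le> norm (A *v x) + norm (B *v x)"
    by (simp add: matrix_vector_mult_add_rdistrib norm_triangle_ineq)
  also have "\<dots> \<le> (op_norm A + op_norm B) * norm x"
    by (simp add: distrib_right add_mono norm_matrix_vector_le)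
  finally show "norm ((A + B) *v x) \<le> (op_norm A + op_norm B) * norm x" .
qed

lemma op_norm_minus_commute: "op_norm (A - B) = op_norm (B - A :: real^'n^'n)"
  unfolding op_norm_def
  by (simp add: matrix_vector_mult_diff_rdistrib onorm_def norm_minus_commute)

lemma bounded_imp_op_norm_bounded:
  fixes \<A> :: "(real^'n^'n) set"
  assumes "bounded \<A>"
  obtains R where "\<And>A. A \<in> \<A> \<Longrightarrow> op_norm A \<le> R"
proof -
  obtain b where b: "\<And>A. A \<in> \<A> \<Longrightarrow> norm A \<le> b"
    using assms unfolding bounded_iff by blast
  have "op_norm A \<le> real CARD('n) * real CARD('n) * b" if "A \<in> \<A>" for A
  proof -
    have "\<bar>A $ i $ j\<bar> \<le> b" for i j
      using Finite_Cartesian_Product.norm_nth_le[of A i]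
        Finite_Cartesian_Product.norm_nth_le[of "A $ i" j] b[OF that] by simp
    then show ?thesis unfolding op_norm_def by (rule onorm_le_matrix_component)
  qed
  with that show thesis by blast
qed

section \<open>The Hausdorff distance\<close>

lemma hausdorff_dist_commute: "hausdorff_dist \<A> \<B> = hausdorff_dist \<B> \<A>"
  unfolding hausdorff_dist_def by (simp add: op_norm_minus_commute max.commute)

text \<open>If \<open>\<A>\<close> were unbounded, the supremum over \<open>\<A>\<close> in the definition of the Hausdorff distance
  would be an unspecified number.\<close>

lemma hausdorff_dist_close_point:
  fixes \<A> \<B> :: "(real^'n^'n) set"
  assumes "bounded \<A>" "\<B> \<noteq> {}" "hausdorff_dist \<A> \<B> < \<delta>" "A \<in> \<A>"
  obtains B where "B \<in> \<B>" "op_norm (A - B) < \<delta>"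
proof -
  obtain B0 where B0: "B0 \<in> \<B>" using assms(2) by blast
  have "bounded ((\<lambda>A. A - B0) ` \<A>)"
    using assms(1) bounded_translation[of \<A> "- B0"] by simp
  then obtain R where R: "\<And>A. A \<in> (\<lambda>A. A - B0) ` \<A> \<Longrightarrow> op_norm A \<le> R"
    by (rule bounded_imp_op_norm_bounded) blast
  have below: "bdd_below ((\<lambda>B. op_norm (A - B)) ` \<B>)" for A
    by (rule bdd_belowI[of _ 0]) (auto simp: op_norm_nonneg)
  have "(INF B\<in>\<B>. op_norm (A - B)) \<le> R" if "A \<in> \<A>" for A
    by (rule order_trans[OF cINF_lower[OF below B0] R]) (use that in blast)
  then have "(INF B\<in>\<B>. op_norm (A - B)) \<le> (SUP A\<in>\<A>. INF B\<in>\<B>. op_norm (A - B))"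
    by (intro cSUP_upper[OF assms(4)] bdd_aboveI[of _ R]) auto
  also have "\<dots> < \<delta>" using assms(3) unfolding hausdorff_dist_def by simp
  finally have "(INF B\<in>\<B>. op_norm (A - B)) < \<delta>" .
  then show thesis
    using that cInf_lessD[of "(\<lambda>B. op_norm (A - B)) ` \<B>" \<delta>] assms(2) by blast
qed

section \<open>Existence of the limit\<close>

text \<open>Fekete's lemma in multiplicative form. Given \<open>y\<close> above the infimum, fix one \<open>m\<close> with
  \<open>a m \<le> y ^ m\<close>; dividing \<open>n\<close> by \<open>m\<close> with remainder gives \<open>a n \<le> D * y ^ n\<close>, where the constant
  \<open>D\<close> collects the finitely many remainders and disappears under the \<open>n\<close>-th root.\<close>

lemma root_submultiplicative_convergent:
  fixes a :: "nat \<Rightarrow> real"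
  assumes nonneg: "\<And>n. 0 \<le> a n" and submult: "\<And>m n. a (m + n) \<le> a m * a n"
  shows "convergent (\<lambda>n. root n (a n))"
proof -
  define L where "L = (INF n\<in>{1..}. root n (a n))"
  have below: "bdd_below ((\<lambda>n. root n (a n)) ` {1..})"
    by (rule bdd_belowI[of _ 0]) (auto simp: nonneg)
  have L0: "0 \<le> L" unfolding L_def by (rule cINF_greatest) (auto simp: nonneg)
  have "(\<lambda>n. root n (a n)) \<longlonglongrightarrow> L"
  proof (rule order_tendstoI)
    fix x assume "x < L"
    moreover have "L \<le> root n (a n)" if "n \<ge> 1" for n
      unfolding L_def using that by (intro cINF_lower[OF below]) simp
    ultimately show "eventually (\<lambda>n. x < root n (a n)) sequentially"
      by (intro eventually_mono[OF eventually_ge_at_top[of 1]]) (rule less_le_trans)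
  next
    fix x assume "L < x"
    then obtain y where y: "L < y" "y < x" using dense by blast
    have y0: "0 < y" using L0 y by simp
    obtain m where m: "m \<ge> 1" "root m (a m) < y"
      using y(1) cInf_lessD[of "(\<lambda>n. root n (a n)) ` {1..}" y] unfolding L_def by auto
    have am: "a m \<le> y ^ m"
      using m nonneg[of m] power_mono[of "root m (a m)" y m] by simp
    have iter: "a (q * m + r) \<le> (y ^ m) ^ q * a r" for q r
    proof (induction q)
      case (Suc q)
      have "a (Suc q * m + r) \<le> a m * a (q * m + r)"
        using submult[of m "q * m + r"] by (simp add: add.assoc)
      also have "\<dots> \<le> y ^ m * ((y ^ m) ^ q * a r)"
        using am Suc y0 by (intro mult_mono nonneg) auto
      finally show ?case by (simp add: mult.assoc)
    qed simp
    \<comment> \<open>The summand 1 only serves to make \<open>D\<close> positive.\<close>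
    define D where "D = 1 + (\<Sum>r<m. a r / y ^ r)"
    have sum0: "0 \<le> (\<Sum>r<m. a r / y ^ r)"
      using nonneg y0 by (intro sum_nonneg) simp
    have D: "0 < D" unfolding D_def using sum0 by simp
    have bound: "a n \<le> y ^ n * D" for n
    proof -
      define q r where "q = n div m" and "r = n mod m"
      have n: "n = q * m + r" and r: "r < m" using m(1) by (auto simp: q_def r_def)
      have "a n \<le> (y ^ m) ^ q * a r" unfolding n by (rule iter)
      also have "\<dots> = y ^ n * (a r / y ^ r)"
        using y0 by (simp add: n power_add power_mult[symmetric] mult.commute)
      also have "a r / y ^ r \<le> (\<Sum>r<m. a r / y ^ r)"
        using r nonneg y0 by (intro member_le_sum) auto
      then have "y ^ n * (a r / y ^ r) \<le> y ^ n * D"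
        using y0 unfolding D_def by (intro mult_left_mono) auto
      finally show ?thesis .
    qed
    have "(\<lambda>n. y * root n D) \<longlonglongrightarrow> y * 1"
      by (intro tendsto_mult tendsto_const LIMSEQ_root_const D)
    then have "eventually (\<lambda>n. y * root n D < x) sequentially"
      using y(2) by (intro order_tendstoD(2)[where a = x]) auto
    then show "eventually (\<lambda>n. root n (a n) < x) sequentially"
      using eventually_ge_at_top[of 1]
    proof eventually_elim
      case (elim n)
      have "root n (a n) \<le> root n (y ^ n * D)" using elim(2) bound by simp
      also have "\<dots> = y * root n D"
        using elim(2) y0 by (simp add: real_root_mult real_root_power_cancel)
      finally show ?case using elim(1) by simp
    qed
  qed
  then show ?thesis by (rule convergentI)
qed

definition product_norms :: "(real^'n^'n) set \<Rightarrow> nat \<Rightarrow> real set" where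
  "product_norms \<A> n = {op_norm (mat_prod a n) | a. \<forall>i\<in>{1..n}. a i \<in> \<A>}"

lemma product_norms_nonneg: "x \<in> product_norms \<A> n \<Longrightarrow> 0 \<le> x"
  unfolding product_norms_def by (auto simp: op_norm_nonneg)

lemma product_norms_nonempty: "\<A> \<noteq> {} \<Longrightarrow> product_norms \<A> n \<noteq> {}"
  unfolding product_norms_def by auto

lemma bdd_below_product_norms: "bdd_below (product_norms \<A> n)"
  using product_norms_nonneg by (rule bdd_belowI)

lemma root_product_norms_nonneg: "x \<in> root n ` product_norms \<A> n \<Longrightarrow> 0 \<le> x"
  using product_norms_nonneg by (auto intro: real_root_ge_zero)

lemma Inf_root_product_norms_le:
  "x \<in> product_norms \<A> n \<Longrightarrow> Inf (root n ` product_norms \<A> n) \<le> root n x"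
  by (intro cInf_lower bdd_belowI[of _ 0] root_product_norms_nonneg) auto

lemma mat_prod_cong:
  "(\<And>i. i \<in> {1..n} \<Longrightarrow> a i = b i) \<Longrightarrow> mat_prod a n = mat_prod b n"
  by (induction n) auto

lemma mat_prod_add:
  "mat_prod a (m + n) = mat_prod (\<lambda>i. a (m + i)) n ** mat_prod a m"
  by (induction n) (simp_all add: matrix_mul_assoc)

lemma Inf_product_norms_add_le:
  fixes \<A> :: "(real^'n^'n) set"
  assumes "\<A> \<noteq> {}"
  shows "Inf (product_norms \<A> (m + n)) \<le> Inf (product_norms \<A> m) * Inf (product_norms \<A> n)"
proof -
  let ?c = "Inf (product_norms \<A> (m + n))"
  have prod: "?c \<le> x * y" if x: "x \<in> product_norms \<A> m" and y: "y \<in> product_norms \<A> n" for x y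
  proof -
    obtain a where a: "\<forall>i\<in>{1..m}. a i \<in> \<A>" "x = op_norm (mat_prod a m)"
      using x unfolding product_norms_def by blast
    obtain b where b: "\<forall>i\<in>{1..n}. b i \<in> \<A>" "y = op_norm (mat_prod b n)"
      using y unfolding product_norms_def by blast
    define c where "c i = (if i \<le> m then a i else b (i - m))" for i
    have "mat_prod c (m + n) = mat_prod b n ** mat_prod a m"
      unfolding mat_prod_add by (intro arg_cong2[where f = "(**)"] mat_prod_cong) (auto simp: c_def)
    moreover have "c i \<in> \<A>" if "i \<in> {1..m + n}" for i
    proof (cases "i \<le> m")
      case False
      then have "i - m \<in> {1..n}" using that by auto
      then show ?thesis using b(1) False by (simp add: c_def)
    qed (use a(1) that in \<open>simp add: c_def\<close>)
    then have "\<forall>i\<in>{1..m + n}. c i \<in> \<A>" by blast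
    ultimately have "op_norm (mat_prod b n ** mat_prod a m) \<in> product_norms \<A> (m + n)"
      unfolding product_norms_def by (auto intro: exI[of _ c])
    then have "?c \<le> op_norm (mat_prod b n ** mat_prod a m)"
      by (intro cInf_lower bdd_below_product_norms)
    also have "\<dots> \<le> x * y"
      using op_norm_mult_le[of "mat_prod b n" "mat_prod a m"] by (simp add: a b mult.commute)
    finally show ?thesis .
  qed
  have inf_mult: "c \<le> t * Inf S"
    if "S \<noteq> {}" "0 \<le> t" "\<And>s. s \<in> S \<Longrightarrow> c \<le> t * s" for c t :: real and S
  proof (cases "t = 0")
    case True
    then show ?thesis using that by auto
  next
    case False
    then have "c / t \<le> Inf S"
      using that by (intro cInf_greatest) (auto simp: divide_simps mult.commute)
    then show ?thesis using False that(2) by (simp add: divide_simps mult.commute)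
  qed
  have step: "?c \<le> x * Inf (product_norms \<A> n)" if "x \<in> product_norms \<A> m" for x
    using that by (intro inf_mult prod product_norms_nonempty assms product_norms_nonneg)
  have "0 \<le> Inf (product_norms \<A> n)"
    by (intro cInf_greatest product_norms_nonempty assms product_norms_nonneg)
  then have "?c \<le> Inf (product_norms \<A> n) * Inf (product_norms \<A> m)"
    using step by (intro inf_mult product_norms_nonempty assms) (auto simp: mult.commute)
  then show ?thesis by (simp add: mult.commute)
qed

lemma LIMSEQ_lower_spectral_radius:
  fixes \<A> :: "(real^'n^'n) set"
  assumes "\<A> \<noteq> {}"
  shows "(\<lambda>n. Inf (root n ` product_norms \<A> n)) \<longlonglongrightarrow> lower_spectral_radius \<A>"
proof -
  have eq: "Inf (root n ` product_norms \<A> n) = root n (Inf (product_norms \<A> n))" for n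
  proof (cases "n = 0")
    case True
    then show ?thesis using product_norms_nonempty[OF assms] by (simp add: image_constant_conv)
  next
    case False
    then have "mono (root n)" by (intro monoI) simp
    moreover have "continuous (at_right (Inf (product_norms \<A> n))) (root n)"
      by (rule continuous_at_imp_continuous_within[OF isCont_real_root])
    ultimately have "root n (Inf (product_norms \<A> n)) = Inf (root n ` product_norms \<A> n)"
      using product_norms_nonempty[OF assms] bdd_below_product_norms
      by (rule continuous_at_Inf_mono)
    then show ?thesis by simp
  qed
  have "0 \<le> Inf (product_norms \<A> n)" for n
    using product_norms_nonempty[OF assms] product_norms_nonneg by (rule cInf_greatest)
  then have "convergent (\<lambda>n. root n (Inf (product_norms \<A> n)))"
    using Inf_product_norms_add_le[OF assms] by (rule root_submultiplicative_convergent)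
  moreover have "{root n (op_norm (mat_prod a n)) | a. \<forall>i\<in>{1..n}. a i \<in> \<A>}
      = root n ` product_norms \<A> n" for n
    unfolding product_norms_def by blast
  ultimately show ?thesis
    unfolding lower_spectral_radius_def by (simp add: eq convergent_LIMSEQ_iff)
qed

lemma lower_spectral_radius_le:
  fixes \<A> :: "(real^'n^'n) set"
  assumes ne: "\<A> \<noteq> {}" and R: "\<And>A. A \<in> \<A> \<Longrightarrow> op_norm A \<le> R"
  shows "lower_spectral_radius \<A> \<le> R"
proof (rule LIMSEQ_le_const2[OF LIMSEQ_lower_spectral_radius[OF ne]])
  obtain A where A: "A \<in> \<A>" using ne by blast
  have R0: "0 \<le> R" using R[OF A] op_norm_nonneg[of A] by simp
  have one: "op_norm (mat 1 :: real^'n^'n) \<le> 1" by (rule op_norm_le) simp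
  have pow: "op_norm (mat_prod (\<lambda>_. A) n) \<le> R ^ n" for n
  proof (induction n)
    case (Suc n)
    have "op_norm (mat_prod (\<lambda>_. A) (Suc n)) \<le> op_norm A * op_norm (mat_prod (\<lambda>_. A) n)"
      by (simp add: op_norm_mult_le)
    also have "\<dots> \<le> R * R ^ n" by (intro mult_mono R A Suc R0 op_norm_nonneg)
    finally show ?case by simp
  qed (use one in simp)
  have "Inf (root n ` product_norms \<A> n) \<le> R" if n: "n \<ge> 1" for n
  proof -
    have "op_norm (mat_prod (\<lambda>_. A) n) \<in> product_norms \<A> n"
      unfolding product_norms_def using A by blast
    then have "Inf (root n ` product_norms \<A> n) \<le> root n (op_norm (mat_prod (\<lambda>_. A) n))"
      by (rule Inf_root_product_norms_le)
    also have "\<dots> \<le> root n (R ^ n)" using pow n by simp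
    also have "\<dots> = R" using R0 n by (simp add: real_root_power_cancel)
    finally show ?thesis .
  qed
  then show "\<exists>N. \<forall>n\<ge>N. Inf (root n ` product_norms \<A> n) \<le> R" by blast
qed

text \<open>The constant factor \<open>K\<close> disappears under the \<open>n\<close>-th root, whereas the exponential factor
  survives as \<open>q\<close>. Accordingly, products need only be compared up to bounded factors.\<close>

lemma lower_spectral_radius_le_mult:
  fixes \<A> \<B> :: "(real^'n^'n) set"
  assumes ne: "\<A> \<noteq> {}" "\<B> \<noteq> {}" and K: "0 < K" and q: "0 < q"
    and cmp: "\<And>n x. x \<in> product_norms \<A> n \<Longrightarrow> \<exists>y\<in>product_norms \<B> n. y \<le> K * q ^ n * x"
  shows "lower_spectral_radius \<B> \<le> q * lower_spectral_radius \<A>"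
proof -
  have le: "Inf (root n ` product_norms \<B> n) \<le> root n K * q * Inf (root n ` product_norms \<A> n)"
    if n: "n \<ge> 1" for n
  proof -
    let ?f = "root n K * q"
    have f: "0 < ?f" using K q n by simp
    have "Inf (root n ` product_norms \<B> n) / ?f \<le> Inf (root n ` product_norms \<A> n)"
    proof (rule cInf_greatest)
      show "root n ` product_norms \<A> n \<noteq> {}" using product_norms_nonempty[OF ne(1)] by simp
      fix t assume "t \<in> root n ` product_norms \<A> n"
      then obtain x where x: "x \<in> product_norms \<A> n" "t = root n x" by blast
      obtain y where y: "y \<in> product_norms \<B> n" "y \<le> K * q ^ n * x" using cmp[OF x(1)] by blast
      have "Inf (root n ` product_norms \<B> n) \<le> root n y"
        by (rule Inf_root_product_norms_le[OF y(1)])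
      also have "\<dots> \<le> root n (K * q ^ n * x)" using y n by simp
      also have "\<dots> = ?f * t"
        using n q by (simp add: x real_root_mult real_root_power_cancel)
      finally show "Inf (root n ` product_norms \<B> n) / ?f \<le> t"
        using f by (simp add: pos_divide_le_eq mult.commute)
    qed
    then show ?thesis using f by (simp add: pos_divide_le_eq mult.commute)
  qed
  have "(\<lambda>n. root n K * q * Inf (root n ` product_norms \<A> n))
      \<longlonglongrightarrow> 1 * q * lower_spectral_radius \<A>"
    by (intro tendsto_mult tendsto_const LIMSEQ_root_const K LIMSEQ_lower_spectral_radius ne)
  then show ?thesis
    using LIMSEQ_le[OF LIMSEQ_lower_spectral_radius[OF ne(2)]] le by auto
qed

section \<open>Uniformly invariant cones\<close>

text \<open>A quantitative form of strict invariance of \<open>C\<close>, with one constant \<open>\<rho>\<close> for all matrices of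
  \<open>M\<close>; unlike the qualitative form, it survives a perturbation of the matrices.\<close>

definition maps_well_inside :: "real \<Rightarrow> (real^'n) set \<Rightarrow> (real^'n^'n) set \<Rightarrow> bool" where
  "maps_well_inside \<rho> C M \<longleftrightarrow> (\<forall>A\<in>M. \<forall>u\<in>C. cball (A *v u) (\<rho> * norm u) \<subseteq> C)"

lemma maps_well_insideD:
  assumes "maps_well_inside \<rho> C M" "0 \<le> \<rho>" "A \<in> M" "u \<in> C"
  shows "cball (A *v u) (\<rho> * norm u) \<subseteq> C" "A *v u \<in> C"
proof -
  show sub: "cball (A *v u) (\<rho> * norm u) \<subseteq> C"
    using assms unfolding maps_well_inside_def by blast
  have "A *v u \<in> cball (A *v u) (\<rho> * norm u)" using assms(2) by simp
  then show "A *v u \<in> C" using sub by blast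
qed

lemma maps_well_inside_mat_prod:
  assumes "maps_well_inside \<rho> C M" "0 \<le> \<rho>" "\<forall>i\<in>{1..n}. a i \<in> M" "u \<in> C"
  shows "mat_prod a n *v u \<in> C"
  using assms(3)
proof (induction n)
  case (Suc n)
  then have "a (Suc n) *v (mat_prod a n *v u) \<in> C"
    by (intro maps_well_insideD(2)[OF assms(1,2)] Suc.IH) auto
  then show ?case by (simp add: matrix_vector_mul_assoc)
qed (use assms(4) in simp)

text \<open>The foot of the perpendicular from \<open>x\<close> to the hyperplane orthogonal to \<open>y\<close> must lie outside
  the ball.\<close>

lemma inner_ge_if_nonzero_on_cball:
  fixes x y :: "'a::euclidean_space"
  assumes "\<And>w. w \<in> cball x t \<Longrightarrow> y \<bullet> w \<noteq> 0"
  shows "t * norm y \<le> \<bar>y \<bullet> x\<bar>"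
proof (rule ccontr)
  assume "\<not> ?thesis"
  then have less: "\<bar>y \<bullet> x\<bar> < t * norm y" by simp
  then have y: "y \<noteq> 0" by auto
  define w where "w = x - ((y \<bullet> x) / (y \<bullet> y)) *\<^sub>R y"
  have "y \<bullet> w = 0" using y by (simp add: w_def inner_diff_right)
  moreover have "dist x w = \<bar>y \<bullet> x\<bar> / norm y"
    using y by (simp add: w_def dist_norm dot_square_norm power2_eq_square)
  then have "w \<in> cball x t" using less y by (simp add: pos_divide_le_eq)
  ultimately show False using assms by blast
qed

text \<open>Replacing one factor: since \<open>y\<close> vanishes nowhere on \<open>C\<close> and \<open>A *v u\<close> lies deep inside
  \<open>C\<close>, the value \<open>y \<bullet> (A *v u)\<close> is comparable to \<open>norm y * norm u\<close>, so that a small change of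
  \<open>A\<close> is a small \<^emph>\<open>relative\<close> change of this value.\<close>

lemma inner_matrix_perturb_le:
  fixes A A' :: "real^'n^'n"
  assumes inv: "maps_well_inside \<rho> C M" "0 < \<rho>" "A \<in> M" "u \<in> C"
    and y: "\<And>v. v \<in> C \<Longrightarrow> y \<bullet> v \<noteq> 0" and d: "op_norm (A' - A) \<le> \<delta>"
  shows "\<bar>y \<bullet> (A' *v u)\<bar> \<le> (1 + \<delta> / \<rho>) * \<bar>y \<bullet> (A *v u)\<bar>"
proof -
  have \<delta>: "0 \<le> \<delta>" using d op_norm_nonneg[of "A' - A"] by simp
  have lower: "\<rho> * norm u * norm y \<le> \<bar>y \<bullet> (A *v u)\<bar>"
    using maps_well_insideD(1)[OF inv(1) _ inv(3,4)] inv(2) y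
    by (intro inner_ge_if_nonzero_on_cball) auto
  have "\<bar>y \<bullet> ((A' - A) *v u)\<bar> \<le> norm y * norm ((A' - A) *v u)"
    by (rule Cauchy_Schwarz_ineq2)
  also have "\<dots> \<le> norm y * (\<delta> * norm u)"
    by (intro mult_left_mono order_trans[OF norm_matrix_vector_le] mult_right_mono d) auto
  also have "\<dots> = \<delta> / \<rho> * (\<rho> * norm u * norm y)" using inv(2) by simp
  also have "\<dots> \<le> \<delta> / \<rho> * \<bar>y \<bullet> (A *v u)\<bar>"
    using lower \<delta> inv(2) by (intro mult_left_mono) auto
  finally have "\<bar>y \<bullet> ((A' - A) *v u)\<bar> \<le> \<delta> / \<rho> * \<bar>y \<bullet> (A *v u)\<bar>" .
  moreover have "y \<bullet> (A' *v u) = y \<bullet> (A *v u) + y \<bullet> ((A' - A) *v u)"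
    by (simp add: matrix_vector_mult_diff_rdistrib inner_diff_right)
  ultimately show ?thesis by (simp add: distrib_right)
qed

text \<open>The factors are replaced one at a time, from the left. The vector on the right of the
  replaced factor stays in \<open>C\<close> because \<open>C\<close> is invariant; the functional on its left
  stays nonzero on \<open>C\<close> for the same reason. This is why the induction runs over all such \<open>y\<close>.\<close>

lemma inner_mat_prod_perturb_le:
  fixes a b :: "nat \<Rightarrow> real^'n^'n"
  assumes inv: "maps_well_inside \<rho> C M" "0 < \<rho>" and u: "u \<in> C" and \<delta>: "0 \<le> \<delta>"
    and "\<forall>i\<in>{1..n}. a i \<in> M" "\<forall>i\<in>{1..n}. b i \<in> M"
    and "\<forall>i\<in>{1..n}. op_norm (b i - a i) \<le> \<delta>"
    and "\<And>v. v \<in> C \<Longrightarrow> y \<bullet> v \<noteq> 0"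
  shows "\<bar>y \<bullet> (mat_prod b n *v u)\<bar> \<le> (1 + \<delta> / \<rho>) ^ n * \<bar>y \<bullet> (mat_prod a n *v u)\<bar>"
  using assms(5-)
proof (induction n arbitrary: y)
  case (Suc n)
  let ?q = "1 + \<delta> / \<rho>" and ?y = "y v* a (Suc n)"
  have q: "0 \<le> ?q" using \<delta> inv(2) by simp
  have bC: "mat_prod b n *v u \<in> C"
    using Suc.prems(2) inv u by (intro maps_well_inside_mat_prod) auto
  have y': "?y \<bullet> v \<noteq> 0" if "v \<in> C" for v
  proof -
    have "a (Suc n) *v v \<in> C"
      using Suc.prems(1) inv that by (intro maps_well_insideD(2)[OF inv(1)]) auto
    then show ?thesis using Suc.prems(4) by (simp add: dot_lmul_matrix)
  qed
  have "\<bar>y \<bullet> (mat_prod b (Suc n) *v u)\<bar> = \<bar>y \<bullet> (b (Suc n) *v (mat_prod b n *v u))\<bar>"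
    by (simp add: matrix_vector_mul_assoc)
  also have "\<dots> \<le> ?q * \<bar>y \<bullet> (a (Suc n) *v (mat_prod b n *v u))\<bar>"
    using Suc.prems by (intro inner_matrix_perturb_le[OF inv _ bC]) auto
  also have "\<dots> = ?q * \<bar>?y \<bullet> (mat_prod b n *v u)\<bar>" by (simp add: dot_lmul_matrix)
  also have "\<dots> \<le> ?q * (?q ^ n * \<bar>?y \<bullet> (mat_prod a n *v u)\<bar>)"
    using Suc.prems y' by (intro mult_left_mono q Suc.IH) auto
  also have "\<dots> = ?q ^ Suc n * \<bar>y \<bullet> (mat_prod a (Suc n) *v u)\<bar>"
    by (simp add: dot_lmul_matrix matrix_vector_mul_assoc mult.assoc)
  finally show ?case .
qed simp

text \<open>On \<open>C\<close> the functional \<open>y\<close> is comparable to the norm, so it measures the growth under \<open>P\<close>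
  of every vector of \<open>C\<close>; every vector is, up to scaling, the difference of \<open>v\<close> and another
  vector of the ball. The values of \<open>y \<bullet> (P *v w)\<close> on the ball are controlled by the one at the
  center \<open>v\<close> because this functional of \<open>w\<close> has no zero in the ball.\<close>

lemma op_norm_le_inner:
  fixes P :: "real^'n^'n"
  assumes c: "0 < c" "\<And>w. w \<in> C \<Longrightarrow> c * norm w \<le> \<bar>y \<bullet> w\<bar>"
    and s: "0 < s" "cball v s \<subseteq> C" and P: "\<And>w. w \<in> C \<Longrightarrow> P *v w \<in> C - {0}"
  shows "op_norm P \<le> 3 / (c * s) * \<bar>y \<bullet> (P *v v)\<bar>"
proof (rule op_norm_le)
  fix x :: "real^'n"
  let ?g = "\<bar>y \<bullet> (P *v v)\<bar>"
  show "norm (P *v x) \<le> 3 / (c * s) * ?g * norm x"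
  proof (cases "x = 0")
    case False
    define z where "z = (s / norm x) *\<^sub>R x"
    have nz: "norm z = s" using False s(1) by (simp add: z_def)
    have vz: "v + z \<in> C" using s(2) nz by (auto simp: subset_iff dist_norm)
    have v: "v \<in> C" using s by auto
    have nonzero: "(y v* P) \<bullet> w \<noteq> 0" if "w \<in> C" for w
    proof -
      have "0 < c * norm (P *v w)" using c(1) P[OF that] by simp
      also have "\<dots> \<le> \<bar>y \<bullet> (P *v w)\<bar>" using P[OF that] by (intro c(2)) auto
      finally show ?thesis by (simp add: dot_lmul_matrix)
    qed
    have "s * norm (y v* P) \<le> \<bar>(y v* P) \<bullet> v\<bar>"
      using nonzero s(2) by (intro inner_ge_if_nonzero_on_cball) blast
    then have yP: "s * norm (y v* P) \<le> ?g" by (simp add: dot_lmul_matrix)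
    have "\<bar>y \<bullet> (P *v z)\<bar> \<le> norm (y v* P) * norm z"
      unfolding dot_lmul_matrix[symmetric] by (rule Cauchy_Schwarz_ineq2)
    then have "\<bar>y \<bullet> (P *v z)\<bar> \<le> ?g" using yP nz by (simp add: mult.commute)
    then have "\<bar>y \<bullet> (P *v (v + z))\<bar> \<le> 2 * ?g"
      by (simp add: matrix_vector_right_distrib inner_add_right)
    then have "c * norm (P *v (v + z)) \<le> 2 * ?g"
      using c(2)[of "P *v (v + z)"] P[OF vz] by simp
    moreover have "c * norm (P *v v) \<le> ?g" using c(2)[of "P *v v"] P[OF v] by simp
    moreover have "norm (P *v z) \<le> norm (P *v (v + z)) + norm (P *v v)"
      using norm_triangle_ineq4[of "P *v (v + z)" "P *v v"]
      by (simp add: matrix_vector_right_distrib)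
    then have "c * norm (P *v z) \<le> c * norm (P *v (v + z)) + c * norm (P *v v)"
      using c(1) by (simp add: distrib_left[symmetric])
    ultimately have "c * norm (P *v z) \<le> 3 * ?g" by simp
    moreover have "norm (P *v z) = s / norm x * norm (P *v x)"
      using s(1) by (simp add: z_def matrix_vector_mult_scaleR)
    ultimately show ?thesis using c(1) s(1) False by (simp add: field_simps)
  qed simp
qed

text \<open>Norms of products are passed to values of the functional \<open>y\<close> at the images of \<open>v\<close>, where
  the factors can be exchanged, and back. It matters that the constant in front does not
  depend on the length \<open>n\<close>.\<close>

lemma product_norms_perturb_le:
  fixes \<A> \<B> :: "(real^'n^'n) set"
  assumes c: "0 < c" "\<And>w. w \<in> C \<Longrightarrow> c * norm w \<le> \<bar>y \<bullet> w\<bar>" "0 \<notin> C"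
    and s: "0 < s" "cball v s \<subseteq> C"
    and inv: "0 < \<rho>" "maps_well_inside \<rho> C (\<A> \<union> \<B>)"
    and \<delta>: "0 \<le> \<delta>" "\<And>A. A \<in> \<A> \<Longrightarrow> \<exists>B\<in>\<B>. op_norm (B - A) \<le> \<delta>"
    and x: "x \<in> product_norms \<A> n"
  \<comment> \<open>The summand 1 makes the constant positive, so that its \<open>n\<close>-th root tends to 1.\<close>
  shows "\<exists>x'\<in>product_norms \<B> n.
    x' \<le> (3 / (c * s) * norm y * norm v + 1) * (1 + \<delta> / \<rho>) ^ n * x"
proof -
  let ?q = "(1 + \<delta> / \<rho>) ^ n"
  have q: "0 \<le> ?q" using \<delta>(1) inv(1) by simp
  have v: "v \<in> C" using s by auto
  have y: "y \<bullet> w \<noteq> 0" if "w \<in> C" for w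
  proof -
    have "w \<noteq> 0" using c(3) that by blast
    then have "0 < c * norm w" using c(1) by simp
    then show ?thesis using c(2)[OF that] by auto
  qed
  obtain a where a: "\<forall>i\<in>{1..n}. a i \<in> \<A>" "x = op_norm (mat_prod a n)"
    using x unfolding product_norms_def by blast
  have "\<forall>i. \<exists>B. i \<in> {1..n} \<longrightarrow> B \<in> \<B> \<and> op_norm (B - a i) \<le> \<delta>" using a(1) \<delta>(2) by blast
  then obtain b where b: "\<forall>i. i \<in> {1..n} \<longrightarrow> b i \<in> \<B> \<and> op_norm (b i - a i) \<le> \<delta>" by metis
  have bM: "\<forall>i\<in>{1..n}. b i \<in> \<A> \<union> \<B>" using b by blast
  have bC: "mat_prod b n *v w \<in> C - {0}" if "w \<in> C" for w
    using maps_well_inside_mat_prod[OF inv(2) less_imp_le[OF inv(1)] bM that] c(3)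
    by (metis DiffI singletonD)
  have "op_norm (mat_prod b n) \<le> 3 / (c * s) * \<bar>y \<bullet> (mat_prod b n *v v)\<bar>"
    by (rule op_norm_le_inner[OF c(1,2) s bC])
  also have "\<dots> \<le> 3 / (c * s) * (?q * \<bar>y \<bullet> (mat_prod a n *v v)\<bar>)"
    using a(1) b c(1) s(1)
    by (intro mult_left_mono inner_mat_prod_perturb_le[OF inv(2,1) v \<delta>(1)] y) auto
  also have "\<dots> \<le> 3 / (c * s) * (?q * (norm y * (x * norm v)))"
    unfolding a(2) using c(1) s(1) q
    by (intro mult_left_mono order_trans[OF Cauchy_Schwarz_ineq2] norm_matrix_vector_le) auto
  also have "\<dots> \<le> (3 / (c * s) * norm y * norm v + 1) * ?q * x"
    using q product_norms_nonneg[OF x] by (simp add: algebra_simps)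
  finally have "op_norm (mat_prod b n) \<le> (3 / (c * s) * norm y * norm v + 1) * ?q * x" .
  moreover have "op_norm (mat_prod b n) \<in> product_norms \<B> n"
    unfolding product_norms_def using b by blast
  ultimately show ?thesis by blast
qed

section \<open>Multicones\<close>

text \<open>In dimension one, where domination holds by convention, the whole punctured line is a
  multicone.\<close>

lemma dominated_1_iff_multicone:
  fixes \<A> :: "(real^'n^'n) set"
  assumes "\<A> \<in> compact_GL"
  shows "dominated 1 \<A> \<longleftrightarrow> (\<exists>C. multicone 1 \<A> C)"
proof (cases "CARD('n) = 1")
  case True
  have op: "interior (UNIV - {0}) = (UNIV - {0} :: (real^'n) set)"
    by (intro interior_open) auto
  have "A *v v \<noteq> 0" if "A \<in> \<A>" "v \<noteq> 0" for A v
  proof -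
    have "invertible A" using assms that(1) unfolding compact_GL_def by blast
    then show ?thesis
      using that(2) by (metis invertible_def matrix_left_invertible_ker)
  qed
  moreover have "subspace (UNIV :: (real^'n) set)" "dim (UNIV :: (real^'n) set) = 1"
    "subspace {0 :: real^'n}" "dim {0 :: real^'n} = CARD('n) - 1"
    using True by (auto simp: subspace_0 dim_UNIV)
  ultimately have "multicone 1 \<A> (UNIV - {0})"
    unfolding multicone_def op by (intro conjI exI[of _ UNIV] exI[of _ "{0}"]) auto
  then show ?thesis using True unfolding dominated_def by auto
next
  case False
  moreover have "CARD('n) \<ge> 1" by (simp add: Suc_leI)
  ultimately have "1 < CARD('n)" by linarith
  then show ?thesis unfolding dominated_def by auto
qed

context
  fixes \<A> :: "(real^'n^'n) set" and C
  assumes \<A>: "\<A> \<in> compact_GL" and C: "multicone 1 \<A> C"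
begin

lemma multicone_0: "0 \<notin> C"
  using C closedin_imp_subset unfolding multicone_def by fastforce

lemma multicone_scale: "v \<in> C \<Longrightarrow> k \<noteq> 0 \<Longrightarrow> k *\<^sub>R v \<in> C"
  using C unfolding multicone_def by blast

lemma multicone_compact_section: "compact (C \<inter> sphere 0 1)"
proof -
  obtain T where T: "closed T" "C = (UNIV - {0}) \<inter> T"
    using C unfolding multicone_def closedin_closed by blast
  then have "C \<inter> sphere 0 1 = T \<inter> sphere 0 1" by auto
  then show ?thesis using T(1) by (simp add: closed_Int_compact)
qed

text \<open>Strict invariance is uniform by compactness of the set of matrices and of the unit vectors
  of \<open>C\<close>; homogeneity extends it to all of \<open>C\<close>.\<close>

lemma multicone_maps_well_inside:
  obtains \<rho> where "0 < \<rho>" "maps_well_inside \<rho> C \<A>"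
proof -
  let ?K = "(\<lambda>p. fst p *v snd p) ` (\<A> \<times> (C \<inter> sphere 0 1))"
  have "continuous_on (\<A> \<times> (C \<inter> sphere 0 1)) (\<lambda>p. fst p *v snd p)"
    unfolding matrix_vector_mult_def by (intro continuous_intros)
  then have "compact ?K"
    using \<A> multicone_compact_section unfolding compact_GL_def
    by (intro compact_continuous_image compact_Times) auto
  moreover have "?K \<subseteq> (\<Union>A\<in>\<A>. (\<lambda>v. A *v v) ` C)" by auto
  then have "?K \<subseteq> interior C" using C unfolding multicone_def by (meson order_trans)
  ultimately obtain \<rho> where \<rho>: "0 < \<rho>" "(\<Union>x\<in>?K. cball x \<rho>) \<subseteq> interior C"
    using compact_subset_open_imp_cball_epsilon_subset[of ?K "interior C"] by auto
  have "w \<in> C" if A: "A \<in> \<A>" and u: "u \<in> C" and w: "w \<in> cball (A *v u) (\<rho> * norm u)" for A u w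
  proof -
    have u0: "u \<noteq> 0" using u multicone_0 by blast
    define k where "k = inverse (norm u)"
    have k: "0 < k" using u0 by (simp add: k_def)
    have ku: "k *\<^sub>R u \<in> C \<inter> sphere 0 1"
      using u u0 k multicone_scale by (simp add: k_def)
    have "dist (A *v (k *\<^sub>R u)) (k *\<^sub>R w) = k * dist (A *v u) w"
      using k by (simp add: matrix_vector_mult_scaleR dist_norm scaleR_diff_right[symmetric])
    also have "\<dots> \<le> k * (\<rho> * norm u)" using w k by simp
    also have "\<dots> = \<rho>" using u0 by (simp add: k_def)
    finally have "k *\<^sub>R w \<in> cball (A *v (k *\<^sub>R u)) \<rho>" by simp
    moreover have "A *v (k *\<^sub>R u) \<in> ?K" using A ku by force
    ultimately have "k *\<^sub>R w \<in> C" using \<rho>(2) interior_subset by blast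
    then show ?thesis using k multicone_scale[of "k *\<^sub>R w" "inverse k"] by simp
  qed
  then show thesis using that \<rho>(1) unfolding maps_well_inside_def by blast
qed

lemma multicone_nonempty: "C \<noteq> {}"
proof -
  obtain E where E: "subspace E" "dim E = 1" "E \<subseteq> C \<union> {0}"
    using C unfolding multicone_def by blast
  have "\<not> E \<subseteq> {0}" using E(2) dim_eq_0[of E] by simp
  then show ?thesis using E(3) by blast
qed

lemma multicone_contains_cball:
  obtains v s where "0 < s" "cball v s \<subseteq> C"
proof -
  obtain \<rho> where \<rho>: "0 < \<rho>" "maps_well_inside \<rho> C \<A>" by (rule multicone_maps_well_inside)
  obtain u where u: "u \<in> C" using multicone_nonempty by blast
  obtain A where "A \<in> \<A>" using \<A> unfolding compact_GL_def by blast
  then have "cball (A *v u) (\<rho> * norm u) \<subseteq> C"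
    using maps_well_insideD(1)[OF \<rho>(2)] \<rho>(1) u by simp
  moreover have "u \<noteq> 0" using u multicone_0 by blast
  then have "0 < \<rho> * norm u" using \<rho>(1) by simp
  ultimately show thesis by (rule that[rotated])
qed

text \<open>The hyperplane disjoint from \<open>C\<close> is the kernel of a functional that has no zero on \<open>C\<close>;
  compactness of the unit vectors of \<open>C\<close> makes this quantitative.\<close>

lemma multicone_functional:
  obtains y c where "0 < c" "\<And>w. w \<in> C \<Longrightarrow> c * norm w \<le> \<bar>y \<bullet> w\<bar>"
proof -
  obtain F where F: "subspace F" "dim F = CARD('n) - 1" "F \<inter> C = {}"
    using C unfolding multicone_def by blast
  then have "dim F = DIM(real^'n) - 1" by simp
  then obtain y where y: "F = {x. y \<bullet> x = 0}"
    using F(1) unfolding dim_eq_hyperplane by (metis span_eq_iff)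
  let ?S = "C \<inter> sphere 0 1"
  have unit: "(1 / norm w) *\<^sub>R w \<in> ?S" if "w \<in> C" for w
    using that multicone_0 multicone_scale[OF that, of "1 / norm w"] by auto
  have "?S \<noteq> {}" using unit multicone_nonempty by blast
  moreover have "continuous_on ?S (\<lambda>w. \<bar>y \<bullet> w\<bar>)" by (intro continuous_intros)
  ultimately obtain w0 where w0: "w0 \<in> ?S" "\<forall>w\<in>?S. \<bar>y \<bullet> w0\<bar> \<le> \<bar>y \<bullet> w\<bar>"
    using continuous_attains_inf[OF multicone_compact_section] by blast
  show thesis
  proof (rule that)
    show "0 < \<bar>y \<bullet> w0\<bar>" using w0(1) F(3) y by auto
    fix w assume w: "w \<in> C"
    then have "0 < norm w" using multicone_0 by auto
    moreover have "\<bar>y \<bullet> w0\<bar> \<le> \<bar>y \<bullet> ((1 / norm w) *\<^sub>R w)\<bar>" using w0(2) unit[OF w] by blast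
    ultimately show "\<bar>y \<bullet> w0\<bar> * norm w \<le> \<bar>y \<bullet> w\<bar>" by (simp add: field_simps)
  qed
qed

text \<open>A matrix within \<open>\<rho> / 2\<close> of one that maps \<open>C\<close> inside with margin \<open>\<rho>\<close> retains half of the
  margin.\<close>

lemma multicone_perturb:
  obtains \<rho> where "0 < \<rho>"
    "\<And>\<B>. hausdorff_dist \<A> \<B> < \<rho> \<Longrightarrow> \<B> \<in> compact_GL \<Longrightarrow> multicone 1 \<B> C"
    "\<And>\<B>. hausdorff_dist \<A> \<B> < \<rho> \<Longrightarrow> \<B> \<in> compact_GL \<Longrightarrow> maps_well_inside \<rho> C \<B>"
proof -
  obtain \<rho> where \<rho>: "0 < \<rho>" "maps_well_inside \<rho> C \<A>" by (rule multicone_maps_well_inside)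
  have well: "maps_well_inside (\<rho> / 2) C \<B>"
    if d: "hausdorff_dist \<A> \<B> < \<rho> / 2" and \<B>: "\<B> \<in> compact_GL" for \<B>
    unfolding maps_well_inside_def
  proof (intro ballI)
    fix B u assume B: "B \<in> \<B>" and u: "u \<in> C"
    obtain A where A: "A \<in> \<A>" "op_norm (B - A) < \<rho> / 2"
      using hausdorff_dist_close_point[of \<B> \<A> "\<rho> / 2" B] d \<A> \<B> B
      by (auto simp: hausdorff_dist_commute compact_GL_def compact_imp_bounded)
    have "dist (A *v u) (B *v u) = norm ((B - A) *v u)"
      by (simp add: dist_norm norm_minus_commute matrix_vector_mult_diff_rdistrib)
    also have "\<dots> \<le> \<rho> / 2 * norm u"
      using A(2) by (intro order_trans[OF norm_matrix_vector_le] mult_right_mono) auto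
    finally have "dist (A *v u) (B *v u) \<le> \<rho> / 2 * norm u" .
    then have "cball (B *v u) (\<rho> / 2 * norm u) \<subseteq> cball (A *v u) (\<rho> * norm u)"
      by (subst cball_subset_cball_iff) (auto simp: dist_commute)
    also have "\<dots> \<subseteq> C" using maps_well_insideD(1)[OF \<rho>(2)] \<rho>(1) A(1) u by simp
    finally show "cball (B *v u) (\<rho> / 2 * norm u) \<subseteq> C" .
  qed
  have cone: "multicone 1 \<B> C"
    if "hausdorff_dist \<A> \<B> < \<rho> / 2" "\<B> \<in> compact_GL" for \<B>
  proof -
    have "B *v u \<in> interior C" if "B \<in> \<B>" "u \<in> C" for B u
    proof -
      have "cball (B *v u) (\<rho> / 2 * norm u) \<subseteq> C"
        using maps_well_insideD(1)[OF well] \<open>hausdorff_dist \<A> \<B> < \<rho> / 2\<close> \<open>\<B> \<in> compact_GL\<close> \<rho>(1) that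
        by simp
      moreover have "u \<noteq> 0" using that(2) multicone_0 by blast
      then have "0 < \<rho> / 2 * norm u" using \<rho>(1) by simp
      ultimately show ?thesis unfolding mem_interior_cball by blast
    qed
    then have "(\<Union>B\<in>\<B>. (\<lambda>v. B *v v) ` C) \<subseteq> interior C" by blast
    then show ?thesis using C unfolding multicone_def by blast
  qed
  show thesis
    by (rule that[of "\<rho> / 2"]) (use \<rho>(1) well cone in auto)
qed

text \<open>All sets near \<open>\<A>\<close> share the cone \<open>C\<close> with one margin \<open>\<rho>\<close>, hence
  \<open>lower_spectral_radius \<B>' \<le> (1 + \<delta> / \<rho>) * lower_spectral_radius \<B>\<close> whenever \<open>\<delta>\<close> exceeds
  the distance of \<open>\<B>\<close> and \<open>\<B>'\<close>. A common bound \<open>R\<close> for the lower spectral radii turns this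
  multiplicative estimate into an additive one with Lipschitz constant \<open>R / \<rho>\<close>.\<close>

lemma lower_spectral_radius_lipschitz_near_multicone:
  obtains \<epsilon> L where "0 < \<epsilon>" "0 \<le> L"
    "\<And>\<B> \<B>'. \<B> \<in> compact_GL \<Longrightarrow> \<B>' \<in> compact_GL \<Longrightarrow> hausdorff_dist \<A> \<B> < \<epsilon> \<Longrightarrow>
      hausdorff_dist \<A> \<B>' < \<epsilon> \<Longrightarrow>
      \<bar>lower_spectral_radius \<B> - lower_spectral_radius \<B>'\<bar> \<le> L * hausdorff_dist \<B> \<B>'"
proof -
  obtain \<rho> where \<rho>: "0 < \<rho>"
    "\<And>\<B>. hausdorff_dist \<A> \<B> < \<rho> \<Longrightarrow> \<B> \<in> compact_GL \<Longrightarrow> maps_well_inside \<rho> C \<B>"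
    by (rule multicone_perturb) blast
  obtain y c where c: "0 < c" "\<And>w. w \<in> C \<Longrightarrow> c * norm w \<le> \<bar>y \<bullet> w\<bar>"
    by (rule multicone_functional) blast
  obtain v s where s: "0 < s" "cball v s \<subseteq> C" by (rule multicone_contains_cball)
  obtain R0 where R0: "\<And>A. A \<in> \<A> \<Longrightarrow> op_norm A \<le> R0"
    using \<A> bounded_imp_op_norm_bounded compact_imp_bounded unfolding compact_GL_def by blast
  define R where "R = R0 + \<rho>"
  have "\<A> \<noteq> {}" using \<A> by (simp add: compact_GL_def)
  then have "0 \<le> R0" using R0 op_norm_nonneg order_trans by blast
  then have R: "0 < R" using \<rho>(1) by (simp add: R_def)
  let ?r = "lower_spectral_radius"
  have upper: "?r \<B> \<le> R" if \<B>: "\<B> \<in> compact_GL" and d: "hausdorff_dist \<A> \<B> < \<rho>" for \<B>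
  proof (rule lower_spectral_radius_le)
    show "\<B> \<noteq> {}" using \<B> by (simp add: compact_GL_def)
    fix B assume B: "B \<in> \<B>"
    obtain A where A: "A \<in> \<A>" "op_norm (B - A) < \<rho>"
      using hausdorff_dist_close_point[of \<B> \<A> \<rho> B] d \<A> \<B> B
      by (auto simp: hausdorff_dist_commute compact_GL_def compact_imp_bounded)
    then show "op_norm B \<le> R" using op_norm_add_le[of A "B - A"] R0[OF A(1)] by (simp add: R_def)
  qed
  have one_side: "?r \<B>' \<le> ?r \<B> + R / \<rho> * \<delta>"
    if \<B>: "\<B> \<in> compact_GL" "\<B>' \<in> compact_GL" "hausdorff_dist \<A> \<B> < \<rho>"
      "hausdorff_dist \<A> \<B>' < \<rho>" and \<delta>: "0 \<le> \<delta>" "hausdorff_dist \<B> \<B>' < \<delta>" for \<B> \<B>' \<delta>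
  proof -
    have ne: "\<B> \<noteq> {}" "\<B>' \<noteq> {}" and bd: "bounded \<B>"
      using \<B>(1,2) by (auto simp: compact_GL_def compact_imp_bounded)
    have inv: "maps_well_inside \<rho> C (\<B> \<union> \<B>')"
      using \<rho>(2) \<B> unfolding maps_well_inside_def by blast
    have close: "\<exists>B'\<in>\<B>'. op_norm (B' - B) \<le> \<delta>" if "B \<in> \<B>" for B
      using hausdorff_dist_close_point[OF bd ne(2) \<delta>(2) that]
      by (metis less_imp_le op_norm_minus_commute)
    have "0 < 3 / (c * s) * norm y * norm v + 1"
      using c(1) s(1) by (simp add: add_nonneg_pos)
    then have "?r \<B>' \<le> (1 + \<delta> / \<rho>) * ?r \<B>"
      using \<delta>(1) \<rho>(1)
      by (intro lower_spectral_radius_le_mult[OF ne, where K = "3 / (c * s) * norm y * norm v + 1"]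
          product_norms_perturb_le[OF c multicone_0 s \<rho>(1) inv \<delta>(1) close])
         (auto simp: add_pos_nonneg)
    also have "\<dots> = ?r \<B> + \<delta> / \<rho> * ?r \<B>" by (simp add: distrib_right)
    also have "\<delta> / \<rho> * ?r \<B> \<le> \<delta> / \<rho> * R"
      using \<delta>(1) \<rho>(1) upper \<B> by (intro mult_left_mono) auto
    finally show ?thesis by (simp add: mult.commute)
  qed
  show thesis
  proof (rule that)
    show "0 < \<rho>" "0 \<le> R / \<rho>" using \<rho>(1) R by auto
    fix \<B> \<B>' :: "(real^'n^'n) set"
    assume \<B>: "\<B> \<in> compact_GL" "\<B>' \<in> compact_GL"
      "hausdorff_dist \<A> \<B> < \<rho>" "hausdorff_dist \<A> \<B>' < \<rho>"
    let ?d = "hausdorff_dist \<B> \<B>'"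
    have nonneg: "0 \<le> \<delta>" if d: "?d < \<delta>" for \<delta>
    proof -
      obtain B where B: "B \<in> \<B>" using \<B>(1) by (auto simp: compact_GL_def)
      have "bounded \<B>" "\<B>' \<noteq> {}"
        using \<B>(1,2) by (auto simp: compact_GL_def compact_imp_bounded)
      then obtain B' where "op_norm (B - B') < \<delta>"
        using hausdorff_dist_close_point[OF _ _ d B] by blast
      then show ?thesis using op_norm_nonneg[of "B - B'"] by simp
    qed
    have bound: "\<bar>?r \<B> - ?r \<B>'\<bar> \<le> R / \<rho> * \<delta>" if "?d < \<delta>" for \<delta>
      using one_side[OF \<B> nonneg[OF that] that]
        one_side[OF \<B>(2,1,4,3) nonneg[OF that]] that
      by (simp add: hausdorff_dist_commute abs_le_iff)
    have R\<rho>: "0 < R / \<rho>" using R \<rho>(1) by simp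
    have "\<bar>?r \<B> - ?r \<B>'\<bar> / (R / \<rho>) \<le> ?d"
    proof (rule dense_ge)
      fix \<delta> assume "?d < \<delta>"
      then have "\<bar>?r \<B> - ?r \<B>'\<bar> \<le> \<delta> * (R / \<rho>)" by (subst mult.commute) (rule bound)
      then show "\<bar>?r \<B> - ?r \<B>'\<bar> / (R / \<rho>) \<le> \<delta>"
        unfolding pos_divide_le_eq[OF R\<rho>] .
    qed
    then have "\<bar>?r \<B> - ?r \<B>'\<bar> \<le> ?d * (R / \<rho>)" unfolding pos_divide_le_eq[OF R\<rho>] .
    then show "\<bar>?r \<B> - ?r \<B>'\<bar> \<le> R / \<rho> * ?d" by (subst mult.commute)
  qed
qed

end

theorem theorem2:
  fixes \<D> :: "(real^'n^'n) set set"
  assumes "\<D> = {\<A> \<in> compact_GL. dominated 1 \<A>}"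
  shows "(\<forall>\<A>\<in>\<D>. \<exists>\<epsilon>>0. \<forall>\<B>\<in>compact_GL. hausdorff_dist \<A> \<B> < \<epsilon> \<longrightarrow> \<B> \<in> \<D>)
    \<and> (\<forall>\<A>\<in>\<D>. \<exists>\<epsilon>>0. \<exists>L\<ge>0. \<forall>\<B>\<in>\<D>. \<forall>\<B>'\<in>\<D>.
         hausdorff_dist \<A> \<B> < \<epsilon> \<longrightarrow> hausdorff_dist \<A> \<B>' < \<epsilon> \<longrightarrow>
         \<bar>lower_spectral_radius \<B> - lower_spectral_radius \<B>'\<bar> \<le> L * hausdorff_dist \<B> \<B>')"
proof (intro conjI ballI)
  fix \<A> assume "\<A> \<in> \<D>"
  then have \<A>: "\<A> \<in> compact_GL" "dominated 1 \<A>" using assms by auto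
  then obtain C where C: "multicone 1 \<A> C" using dominated_1_iff_multicone by blast
  show "\<exists>\<epsilon>>0. \<forall>\<B>\<in>compact_GL. hausdorff_dist \<A> \<B> < \<epsilon> \<longrightarrow> \<B> \<in> \<D>"
    using multicone_perturb[OF \<A>(1) C] dominated_1_iff_multicone assms
    by (metis (mono_tags, lifting) mem_Collect_eq)
next
  fix \<A> assume "\<A> \<in> \<D>"
  then have \<A>: "\<A> \<in> compact_GL" "dominated 1 \<A>" using assms by auto
  then obtain C where C: "multicone 1 \<A> C" using dominated_1_iff_multicone by blast
  obtain \<epsilon> L where \<epsilon>: "0 < \<epsilon>" "0 \<le> L"
    "\<And>\<B> \<B>'. \<B> \<in> compact_GL \<Longrightarrow> \<B>' \<in> compact_GL \<Longrightarrow> hausdorff_dist \<A> \<B> < \<epsilon> \<Longrightarrow>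
      hausdorff_dist \<A> \<B>' < \<epsilon> \<Longrightarrow>
      \<bar>lower_spectral_radius \<B> - lower_spectral_radius \<B>'\<bar> \<le> L * hausdorff_dist \<B> \<B>'"
    by (rule lower_spectral_radius_lipschitz_near_multicone[OF \<A>(1) C]) blast
  then show "\<exists>\<epsilon>>0. \<exists>L\<ge>0. \<forall>\<B>\<in>\<D>. \<forall>\<B>'\<in>\<D>.
      hausdorff_dist \<A> \<B> < \<epsilon> \<longrightarrow> hausdorff_dist \<A> \<B>' < \<epsilon> \<longrightarrow>
      \<bar>lower_spectral_radius \<B> - lower_spectral_radius \<B>'\<bar> \<le> L * hausdorff_dist \<B> \<B>'"
    using assms by blast
qed

end
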